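(* Let $d\ge3$ and let $\lambda_1,\dots,\lambda_d$ be real numbers with $0<\lambda_i<\frac12$ for all $i$, which are algebraically independent over $\mathbb{Q}$. Let $\gamma_d$ be the automorphism of $\mathbb{C}^d$ given by $$\gamma_d:(x_1,x_2,x_3,\dots,x_d)\mapsto\left(\lambda_1(x_2+x_1x_3),\ \lambda_2x_1,\ \lambda_3x_3,\ \dots,\ \lambda_dx_d\right).$$ Then: 1. There exists a holomorphic diffeomorphism (biholomorphic map) $U:\mathbb{C}^d\to\mathbb{C}^d$ such that $U\circ\gamma_d\circ U^{-1}$ is linear. 2. There is no polynomial automorphism $U$ of $\mathbb{C}^d$ such that $U\circ\gamma_d\circ U^{-1}$ is linear.
   Context: A polynomial automorphism of $\mathbb{C}^d$ is a bijective polynomial map $\mathbb{C}^d\to\mathbb{C}^d$ whose inverse is also polynomial. "Linear" means a $\mathbb{C}$-linear map $\mathbb{C}^d\to\mathbb{C}^d$. In the formula for $\gamma_d$, the $i$-th coordinate of the image is $\lambda_ix_i$ for every $3\le i\le d$. *)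

theory Defs
  imports "HOL-Analysis.Analysis"
begin

text \<open>
  \<open>\<complex>\<^sup>d\<close> is the type \<open>complex ^ 'n\<close> with \<open>d = CARD('n)\<close>. A polynomial in the variables indexed by \<open>'n\<close>
  is given by a finite set of exponent vectors \<open>'n \<Rightarrow> nat\<close> and a coefficient for each of them.
\<close>

definition monomial_at :: "'a::comm_semiring_1 ^ 'n \<Rightarrow> ('n::finite \<Rightarrow> nat) \<Rightarrow> 'a" where
  "monomial_at x m = (\<Prod>i\<in>UNIV. x $ i ^ m i)"

definition polynomial_fun :: "(complex ^ 'n::finite \<Rightarrow> complex) \<Rightarrow> bool" where
  "polynomial_fun f \<longleftrightarrow>
     (\<exists>M c. finite M \<and> (\<forall>x. f x = (\<Sum>m\<in>M. c m * monomial_at x m)))"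

definition polynomial_map :: "(complex ^ 'n::finite \<Rightarrow> complex ^ 'n) \<Rightarrow> bool" where
  "polynomial_map f \<longleftrightarrow> (\<forall>i. polynomial_fun (\<lambda>x. f x $ i))"

definition polynomial_automorphism :: "(complex ^ 'n::finite \<Rightarrow> complex ^ 'n) \<Rightarrow> bool" where
  "polynomial_automorphism f \<longleftrightarrow> bij f \<and> polynomial_map f \<and> polynomial_map (inv f)"

text \<open>
  \<open>linear\<close> is reserved for \<open>\<real>\<close>-linear maps; \<open>\<complex>\<close>-linearity is taken with respect to \<open>(*s)\<close>.
\<close>

definition complex_linear :: "(complex ^ 'n::finite \<Rightarrow> complex ^ 'n) \<Rightarrow> bool" where
  "complex_linear f \<longleftrightarrow> Vector_Spaces.linear (*s) (*s) f"

text \<open>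
  The library's \<open>holomorphic_on\<close> covers one complex variable only. In several variables a map is
  holomorphic iff it is Frechet differentiable everywhere with \<open>\<complex>\<close>-linear derivative.
\<close>

definition holomorphic_map :: "(complex ^ 'n::finite \<Rightarrow> complex ^ 'n) \<Rightarrow> bool" where
  "holomorphic_map f \<longleftrightarrow>
     (\<forall>x. \<exists>f'. (f has_derivative f') (at x) \<and> complex_linear f')"

definition biholomorphic_map :: "(complex ^ 'n::finite \<Rightarrow> complex ^ 'n) \<Rightarrow> bool" where
  "biholomorphic_map f \<longleftrightarrow> bij f \<and> holomorphic_map f \<and> holomorphic_map (inv f)"

definition algebraically_independent_over_rat :: "real ^ 'n::finite \<Rightarrow> bool" where
  "algebraically_independent_over_rat l \<longleftrightarrow>
     (\<forall>M (c :: ('n \<Rightarrow> nat) \<Rightarrow> rat).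
        finite M \<and> (\<Sum>m\<in>M. of_rat (c m) * monomial_at l m) = 0 \<longrightarrow> (\<forall>m\<in>M. c m = 0))"

text \<open>
  The parameter \<open>e\<close> enumerates the coordinates: the \<open>i\<close>-th coordinate of \<open>x\<close> (\<open>1 \<le> i \<le> d\<close>) is
  \<open>x $ e i\<close>, and \<open>\<lambda>\<^sub>i\<close> is \<open>l $ e i\<close>. The last case therefore covers exactly the coordinates
  \<open>3, \<dots>, d\<close>.
\<close>

definition gamma_map ::
  "(nat \<Rightarrow> 'n::finite) \<Rightarrow> real ^ 'n \<Rightarrow> complex ^ 'n \<Rightarrow> complex ^ 'n" where
  "gamma_map e l x = (\<chi> j.
     if j = e 1 then of_real (l $ e 1) * (x $ e 2 + x $ e 1 * x $ e 3)
     else if j = e 2 then of_real (l $ e 2) * x $ e 1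
     else of_real (l $ j) * x $ j)"

end

theory Submission
  imports Defs
begin

text \<open>
  Write \<open>a, b, c\<close> for \<open>\<lambda>\<^sub>1, \<lambda>\<^sub>2, \<lambda>\<^sub>3\<close>. For fixed \<open>z = x\<^sub>3\<close> the map \<open>\<gamma>\<^sub>d\<close> acts on \<open>(x\<^sub>1, x\<^sub>2)\<close> by
  the matrix \<open>A(z)\<close> with rows \<open>(a z, a)\<close> and \<open>(b, 0)\<close>, and it contracts \<open>z\<close> to \<open>c z\<close>.

  \<^bold>\<open>Holomorphic linearization.\<close> The matrix \<open>A(0)\<close> has the eigenvalues \<open>\<plusminus>\<sigma>\<close> with \<open>\<sigma> = \<surd>(a b)\<close>. One looks
  for row vectors \<open>R(z)\<close> that are entire in \<open>z\<close> and satisfy \<open>R(c z) A(z) = \<plusminus>\<sigma> R(z)\<close>: two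
  independent ones are the first two rows of a linearizing map that leaves the other coordinates
  alone. With \<open>\<mu> = \<surd>(a / b)\<close> the second entry of \<open>R\<close> is forced to be \<open>\<plusminus>\<mu>\<close> times the first entry
  at \<open>c z\<close>, and in the variable \<open>w = \<mu> z\<close> the first entry \<open>h(\<plusminus>w)\<close> has to solve the single
  \<open>q\<close>-difference equation \<open>h(w) = h(q\<^sup>2 w) + w h(q w)\<close> with \<open>q = c\<close>. Its power series solution
  (\<open>q_series\<close>) is entire because \<open>q\<close> lies in the unit disc. The determinant of the two rows is, up
  to a constant factor, the Casoratian-like expression \<open>h(w) h(-q w) + h(-w) h(q w)\<close>; it is invariant under
  \<open>w \<mapsto> q w\<close>, hence constant, and its value is \<open>2\<close> (\<open>q_series_casoratian\<close>). So the change of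
  coordinates has an inverse with entire entries.

  \<^bold>\<open>No polynomial linearization.\<close> If \<open>U\<close> is a polynomial automorphism and \<open>L = U \<circ> \<gamma> \<circ> U\<^sup>-\<^sup>1\<close> is
  linear, then \<open>\<gamma>\<^sup>n = U\<^sup>-\<^sup>1 \<circ> L\<^sup>n \<circ> U\<close> grows at infinity at most like the power \<open>deg U \<cdot> deg U\<^sup>-\<^sup>1\<close> of the
  norm, for every \<open>n\<close> (\<open>conjugate_iterates_growth\<close>). But \<open>\<gamma>\<^sup>n\<close> has the term \<open>x\<^sub>1 x\<^sub>3\<^sup>n\<close> in its first
  coordinate, and on points with nonnegative coordinates nothing cancels it
  (\<open>gamma_iterates_lower_bound\<close>), so the degrees of the iterates are unbounded.
\<close>

section \<open>An entire solution of a q-difference equation\<close>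

text \<open>
  The coefficients of the solution \<open>h\<close> of \<open>h(z) = h(q\<^sup>2 z) + z h(q z)\<close> with \<open>h(0) = 1\<close>, read off
  by comparing the coefficients of \<open>z ^ Suc n\<close> on both sides.
\<close>

fun q_coeff :: "complex \<Rightarrow> nat \<Rightarrow> complex" where
  "q_coeff q 0 = 1"
| "q_coeff q (Suc n) = q ^ n / (1 - q ^ (2 * Suc n)) * q_coeff q n"

definition q_series :: "complex \<Rightarrow> complex \<Rightarrow> complex" where
  "q_series q z = (\<Sum>n. q_coeff q n * z ^ n)"

lemma norm_one_minus_power_ge:
  fixes q :: complex
  assumes "norm q < 1"
  shows "1 - norm q \<le> norm (1 - q ^ (2 * Suc n))"
proof -
  have "norm q ^ (2 * Suc n) \<le> norm q ^ 1"
    using assms by (intro power_decreasing) auto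
  then show ?thesis
    using norm_triangle_ineq2[of 1 "q ^ (2 * Suc n)"] by (simp add: norm_power norm_mult)
qed

text \<open>
  The quotient of consecutive terms is of the order of \<open>q ^ n * z\<close>, so the ratio test applies at
  every point \<open>z\<close>.
\<close>

lemma summable_q_series:
  assumes q: "norm q < 1"
  shows "summable (\<lambda>n. q_coeff q n * z ^ n)"
proof -
  have "(\<lambda>n. norm q ^ n * (norm z / (1 - norm q))) \<longlonglongrightarrow> 0"
    using q by (intro tendsto_mult_left_zero LIMSEQ_realpow_zero) auto
  then have "\<forall>\<^sub>F n in sequentially. norm q ^ n * (norm z / (1 - norm q)) < 1 / 2"
    by (rule order_tendstoD) simp
  then obtain N where N: "\<And>n. n \<ge> N \<Longrightarrow> norm q ^ n * (norm z / (1 - norm q)) < 1 / 2"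
    by (auto simp: eventually_sequentially)
  show ?thesis
  proof (rule summable_ratio_test[where c = "1 / 2" and N = N])
    fix n assume n: "n \<ge> N"
    have "norm (q_coeff q (Suc n) * z ^ Suc n)
        = norm q ^ n * norm z / norm (1 - q ^ (2 * Suc n)) * norm (q_coeff q n * z ^ n)"
      by (simp add: norm_mult norm_divide norm_power)
    also have "\<dots> \<le> norm q ^ n * norm z / (1 - norm q) * norm (q_coeff q n * z ^ n)"
      using norm_one_minus_power_ge[OF q, of n] q
      by (intro mult_right_mono divide_left_mono) (auto intro!: mult_pos_pos)
    also have "\<dots> \<le> 1 / 2 * norm (q_coeff q n * z ^ n)"
      using N[OF n] by (intro mult_right_mono) auto
    finally show "norm (q_coeff q (Suc n) * z ^ Suc n) \<le> 1 / 2 * norm (q_coeff q n * z ^ n)" .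
  qed simp
qed

lemma q_series_has_field_derivative:
  assumes "norm q < 1"
  shows "(q_series q has_field_derivative (\<Sum>n. diffs (q_coeff q) n * z ^ n)) (at z)"
  using termdiffs_strong_converges_everywhere[OF summable_q_series[OF assms], of z]
  by (simp add: q_series_def[abs_def])

lemma q_series_0: "q_series q 0 = 1"
  by (simp add: q_series_def)

lemma q_series_equation:
  assumes q: "norm q < 1"
  shows "q_series q z = q_series q (q\<^sup>2 * z) + z * q_series q (q * z)"
proof -
  have coeff: "q_coeff q (Suc n) * (1 - q ^ (2 * Suc n)) = q ^ n * q_coeff q n" for n
  proof -
    have "1 - q ^ (2 * Suc n) \<noteq> 0"
      using norm_one_minus_power_ge[OF q, of n] q by (metis diff_gt_0_iff_gt linorder_not_le norm_zero)
    then show ?thesis by simp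
  qed
  have "q_series q z - q_series q (q\<^sup>2 * z)
      = (\<Sum>n. q_coeff q n * z ^ n - q_coeff q n * (q\<^sup>2 * z) ^ n)"
    unfolding q_series_def by (intro suminf_diff summable_q_series q)
  also have "\<dots> = (\<Sum>n. q_coeff q (Suc n) * z ^ Suc n - q_coeff q (Suc n) * (q\<^sup>2 * z) ^ Suc n)"
    using suminf_split_head[OF summable_diff[OF summable_q_series[OF q, of z]
          summable_q_series[OF q, of "q\<^sup>2 * z"]]] by simp
  also have "\<dots> = (\<Sum>n. z * (q_coeff q n * (q * z) ^ n))"
  proof (rule suminf_cong)
    fix n
    have "q_coeff q (Suc n) * z ^ Suc n - q_coeff q (Suc n) * (q\<^sup>2 * z) ^ Suc n
        = (q_coeff q (Suc n) * (1 - q ^ (2 * Suc n))) * z ^ Suc n"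
      by (simp only: power_mult_distrib power_mult[symmetric])
        (simp only: algebra_simps mult_1_left mult_1_right)
    also have "\<dots> = z * (q_coeff q n * (q * z) ^ n)"
      by (simp only: coeff) (simp add: power_mult_distrib)
    finally show "q_coeff q (Suc n) * z ^ Suc n - q_coeff q (Suc n) * (q\<^sup>2 * z) ^ Suc n
        = z * (q_coeff q n * (q * z) ^ n)" .
  qed
  also have "\<dots> = z * q_series q (q * z)"
    unfolding q_series_def by (intro suminf_mult summable_q_series q)
  finally show ?thesis by (simp add: algebra_simps)
qed

text \<open>
  Invariance moves every point along the orbit \<open>q ^ n * z\<close>, which tends to \<open>0\<close>.
\<close>

lemma contraction_invariant_constant:
  fixes f :: "complex \<Rightarrow> 'a::t2_space"
  assumes q: "norm q < 1" and cont: "isCont f 0" and inv: "\<And>z. f (q * z) = f z"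
  shows "f z = f 0"
proof -
  have iter: "f (q ^ n * z) = f z" for n
    by (induction n) (simp_all add: inv mult.assoc)
  have "(\<lambda>n. q ^ n * z) \<longlonglongrightarrow> 0"
    using q by (intro tendsto_mult_left_zero LIMSEQ_power_zero)
  then have "(\<lambda>n. f (q ^ n * z)) \<longlonglongrightarrow> f 0"
    by (rule isCont_tendsto_compose[OF cont])
  then show ?thesis
    by (simp add: iter LIMSEQ_const_iff)
qed

text \<open>
  The functions \<open>h(z)\<close> and \<open>h(-z)\<close> solve two second-order equations that differ only in the sign of
  the middle term. The expression below is their Casoratian (discrete Wronskian), except that the
  two products are added: because of the opposite signs this makes the middle terms cancel, so that
  the expression is invariant under \<open>z \<mapsto> q z\<close> and can be evaluated at \<open>0\<close>.
\<close>

lemma q_series_casoratian: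
  assumes q: "norm q < 1"
  shows "q_series q z * q_series q (- (q * z)) + q_series q (- z) * q_series q (q * z) = 2"
proof -
  define D where
    "D z = q_series q z * q_series q (- (q * z)) + q_series q (- z) * q_series q (q * z)" for z
  have cont: "isCont (q_series q) z" for z
    using q_series_has_field_derivative[OF q] by (rule DERIV_isCont)
  have "isCont D 0"
    unfolding D_def by (intro continuous_intros isCont_o2[OF _ cont])
  moreover have "D (q * z) = D z" for z
  proof -
    have plus: "q_series q z = q_series q (q * (q * z)) + z * q_series q (q * z)"
      using q_series_equation[OF q, of z] by (simp add: power2_eq_square mult.assoc)
    have minus: "q_series q (- z) = q_series q (- (q * (q * z))) - z * q_series q (- (q * z))"
      using q_series_equation[OF q, of "- z"] by (simp add: power2_eq_square mult.assoc)
    show ?thesis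
      unfolding D_def plus minus by (simp add: algebra_simps)
  qed
  ultimately have "D z = D 0"
    by (rule contraction_invariant_constant[OF q])
  then show ?thesis
    by (simp add: D_def q_series_0)
qed

section \<open>Holomorphic functions of several variables\<close>

lemma complex_linear_iff:
  "complex_linear f \<longleftrightarrow> (\<forall>x y. f (x + y) = f x + f y) \<and> (\<forall>c x. f (c *s x) = c *s f x)"
  unfolding complex_linear_def Vector_Spaces.linear_iff using vec.vector_space_axioms by blast

lemma scaleR_eq_vector_scalar_mult:
  fixes x :: "complex ^ 'n"
  shows "r *\<^sub>R x = complex_of_real r *s x"
  unfolding vec_eq_iff vector_scaleR_component vector_smult_component
  by (simp add: scaleR_conv_of_real)

lemma complex_linear_imp_bounded_linear:
  fixes f :: "complex ^ 'n::finite \<Rightarrow> complex ^ 'n"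
  assumes "complex_linear f"
  shows "bounded_linear f"
proof -
  have "linear f"
    using assms unfolding complex_linear_iff
    by (intro linearI) (simp_all add: scaleR_eq_vector_scalar_mult)
  then show ?thesis by (rule linear_conv_bounded_linear[THEN iffD1])
qed

text \<open>
  The scalar-valued counterpart of \<open>holomorphic_map\<close>. Additivity of the derivative is part of
  \<open>has_derivative\<close>, so homogeneity is all that complex linearity adds.
\<close>

definition holomorphic_fun :: "(complex ^ 'n::finite \<Rightarrow> complex) \<Rightarrow> bool" where
  "holomorphic_fun f \<longleftrightarrow>
     (\<forall>x. \<exists>f'. (f has_derivative f') (at x) \<and> (\<forall>c v. f' (c *s v) = c * f' v))"

lemma holomorphic_fun_component:
  fixes i :: "'n::finite"
  shows "holomorphic_fun (\<lambda>x. x $ i)"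
  unfolding holomorphic_fun_def
proof (intro allI exI conjI)
  show "((\<lambda>x. x $ i) has_derivative (\<lambda>v. v $ i)) (at x)" for x :: "complex ^ 'n"
    by (rule bounded_linear.has_derivative[OF bounded_linear_vec_nth has_derivative_ident])
qed simp

lemma holomorphic_fun_add:
  assumes "holomorphic_fun f" "holomorphic_fun g"
  shows "holomorphic_fun (\<lambda>x. f x + g x)"
  unfolding holomorphic_fun_def
proof
  fix x
  obtain f' g' where
    "(f has_derivative f') (at x)" "\<And>c v. f' (c *s v) = c * f' v"
    "(g has_derivative g') (at x)" "\<And>c v. g' (c *s v) = c * g' v"
    using assms unfolding holomorphic_fun_def by metis
  then show "\<exists>h'. ((\<lambda>x. f x + g x) has_derivative h') (at x) \<and> (\<forall>c v. h' (c *s v) = c * h' v)"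
    by (intro exI[of _ "\<lambda>v. f' v + g' v"]) (auto intro!: has_derivative_add simp: algebra_simps)
qed

lemma holomorphic_fun_mult:
  assumes "holomorphic_fun f" "holomorphic_fun g"
  shows "holomorphic_fun (\<lambda>x. f x * g x)"
  unfolding holomorphic_fun_def
proof
  fix x
  obtain f' g' where
    "(f has_derivative f') (at x)" "\<And>c v. f' (c *s v) = c * f' v"
    "(g has_derivative g') (at x)" "\<And>c v. g' (c *s v) = c * g' v"
    using assms unfolding holomorphic_fun_def by metis
  then show "\<exists>h'. ((\<lambda>x. f x * g x) has_derivative h') (at x) \<and> (\<forall>c v. h' (c *s v) = c * h' v)"
    by (intro exI[of _ "\<lambda>v. f x * g' v + f' v * g x"])
      (auto intro!: has_derivative_mult simp: algebra_simps)
qed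

lemma holomorphic_fun_compose_entire:
  assumes g: "\<And>z. (g has_field_derivative g' z) (at z)" and f: "holomorphic_fun f"
  shows "holomorphic_fun (\<lambda>x. g (f x))"
  unfolding holomorphic_fun_def
proof
  fix x
  obtain f' where f': "(f has_derivative f') (at x)" "\<And>c v. f' (c *s v) = c * f' v"
    using f unfolding holomorphic_fun_def by metis
  have "((\<lambda>x. g (f x)) has_derivative (\<lambda>v. g' (f x) * f' v)) (at x)"
    using has_derivative_compose[OF f'(1) g[unfolded has_field_derivative_def]] .
  then show "\<exists>h'. ((\<lambda>x. g (f x)) has_derivative h') (at x) \<and> (\<forall>c v. h' (c *s v) = c * h' v)"
    using f'(2) by auto
qed

lemma holomorphic_map_componentwise:
  fixes f :: "complex ^ 'n::finite \<Rightarrow> complex ^ 'n"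
  assumes "\<And>i. holomorphic_fun (\<lambda>x. f x $ i)"
  shows "holomorphic_map f"
  unfolding holomorphic_map_def
proof
  fix x
  have "\<forall>i. \<exists>f'. ((\<lambda>x. f x $ i) has_derivative f') (at x) \<and> (\<forall>c v. f' (c *s v) = c * f' v)"
    using assms unfolding holomorphic_fun_def by blast
  then obtain F where F: "\<And>i. ((\<lambda>x. f x $ i) has_derivative F i) (at x)"
    "\<And>i c v. F i (c *s v) = c * F i v"
    by (auto dest!: choice)
  have "(f has_derivative (\<lambda>v. \<chi> i. F i v)) (at x)"
    unfolding has_derivative_componentwise_within[of f]
  proof
    fix b :: "complex ^ 'n" assume "b \<in> Basis"
    then obtain i u where b: "b = axis i u"
      by (auto simp: Basis_vec_def)
    show "((\<lambda>x. f x \<bullet> b) has_derivative (\<lambda>v. (\<chi> i. F i v) \<bullet> b)) (at x)"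
      unfolding b inner_axis using has_derivative_inner_left[OF F(1)[of i], of u] by simp
  qed
  moreover have "complex_linear (\<lambda>v. \<chi> i. F i v)"
    unfolding complex_linear_iff
    using F(2) has_derivative_bounded_linear[OF F(1)]
    by (simp add: vec_eq_iff linear_add[OF bounded_linear.linear])
  ultimately show "\<exists>f'. (f has_derivative f') (at x) \<and> complex_linear f'"
    by blast
qed

section \<open>The holomorphic linearization\<close>

text \<open>
  Both directions of the change of coordinates have this shape: a \<open>2 \<times> 2\<close> matrix with rows \<open>(p, r)\<close>
  and \<open>(s, t)\<close>, evaluated at the coordinate \<open>x $ k\<close>, acts on the coordinates \<open>i\<close> and \<open>j\<close>. Since
  \<open>x $ k\<close> is left alone, inverting the map amounts to inverting the matrix pointwise.
\<close>

definition block_map ::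
  "'n \<Rightarrow> 'n \<Rightarrow> 'n \<Rightarrow> (complex \<Rightarrow> complex) \<Rightarrow> (complex \<Rightarrow> complex) \<Rightarrow>
   (complex \<Rightarrow> complex) \<Rightarrow> (complex \<Rightarrow> complex) \<Rightarrow> complex ^ 'n::finite \<Rightarrow> complex ^ 'n" where
  "block_map i j k p r s t x = (\<chi> m.
     if m = i then p (x $ k) * x $ i + r (x $ k) * x $ j
     else if m = j then s (x $ k) * x $ i + t (x $ k) * x $ j
     else x $ m)"

lemma holomorphic_map_block_map:
  assumes "\<exists>p'. \<forall>z. (p has_field_derivative p' z) (at z)"
    and "\<exists>r'. \<forall>z. (r has_field_derivative r' z) (at z)"
    and "\<exists>s'. \<forall>z. (s has_field_derivative s' z) (at z)"
    and "\<exists>t'. \<forall>z. (t has_field_derivative t' z) (at z)"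
  shows "holomorphic_map (block_map i j k p r s t)"
proof (rule holomorphic_map_componentwise)
  fix m
  have entry: "holomorphic_fun (\<lambda>x. f (x $ k))"
    if "\<exists>f'. \<forall>z. (f has_field_derivative f' z) (at z)" for f
    using that holomorphic_fun_compose_entire[OF _ holomorphic_fun_component] by blast
  consider "m = i" | "m \<noteq> i" "m = j" | "m \<noteq> i" "m \<noteq> j" by blast
  then show "holomorphic_fun (\<lambda>x. block_map i j k p r s t x $ m)"
    by cases (simp_all add: block_map_def assms[THEN entry] holomorphic_fun_add holomorphic_fun_mult
        holomorphic_fun_component)
qed

lemma block_map_inverse:
  assumes "i \<noteq> j" "i \<noteq> k" "j \<noteq> k"
    and "\<And>z. p' z * p z + r' z * s z = 1" "\<And>z. p' z * r z + r' z * t z = 0"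
    and "\<And>z. s' z * p z + t' z * s z = 0" "\<And>z. s' z * r z + t' z * t z = 1"
  shows "block_map i j k p' r' s' t' (block_map i j k p r s t x) = x"
proof -
  have lin: "a * (b * u + c * v) + d * (e * u + f * v)
      = (a * b + d * e) * u + (a * c + d * f) * v" for a b c d e f u v :: complex
    by (simp add: algebra_simps)
  show ?thesis
    using assms by (simp add: vec_eq_iff block_map_def lin)
qed

text \<open>
  The linear normal form is \<open>L = diag(\<sigma>, -\<sigma>, \<lambda>\<^sub>3, \<dots>)\<close>, and the rows of the block of \<open>U\<close> are the row vectors
  \<open>(h(\<plusminus>w), \<plusminus>\<mu> h(\<plusminus>q w))\<close> with \<open>w = \<mu> x\<^sub>3\<close>.
\<close>

lemma gamma_map_holomorphically_linearizable:
  fixes e :: "nat \<Rightarrow> 'n::finite"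
  assumes distinct: "e 1 \<noteq> e 2" "e 1 \<noteq> e 3" "e 2 \<noteq> e 3"
    and pos: "0 < l $ e 1" "0 < l $ e 2" and contr: "\<bar>l $ e 3\<bar> < 1"
  shows "\<exists>U. biholomorphic_map U \<and> complex_linear (U \<circ> gamma_map e l \<circ> inv U)"
proof -
  define q where "q = complex_of_real (l $ e 3)"
  define \<mu> where "\<mu> = complex_of_real (sqrt (l $ e 1 / l $ e 2))"
  define \<sigma> where "\<sigma> = complex_of_real (sqrt (l $ e 1 * l $ e 2))"
  have q: "norm q < 1" using contr by (simp add: q_def)
  have \<mu>0: "\<mu> \<noteq> 0" using pos by (simp add: \<mu>_def)
  have sqrts: "\<mu> * \<sigma> = of_real (l $ e 1)" "of_real (l $ e 2) * \<mu> = \<sigma>"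
    using pos
    by (simp_all add: \<mu>_def \<sigma>_def flip: of_real_mult)
      (simp_all add: real_sqrt_divide real_sqrt_mult field_simps flip: power2_eq_square)
  define h where "h = q_series q"
  define U where "U = block_map (e 1) (e 2) (e 3)
    (\<lambda>z. h (\<mu> * z)) (\<lambda>z. \<mu> * h (q * (\<mu> * z)))
    (\<lambda>z. h (- (\<mu> * z))) (\<lambda>z. - \<mu> * h (- (q * (\<mu> * z))))"
  \<comment> \<open>The adjugate of the block of \<open>U\<close> divided by its determinant \<open>- 2 * \<mu>\<close>.\<close>
  define V where "V = block_map (e 1) (e 2) (e 3)
    (\<lambda>z. h (- (q * (\<mu> * z))) / 2) (\<lambda>z. h (q * (\<mu> * z)) / 2)
    (\<lambda>z. h (- (\<mu> * z)) / (2 * \<mu>)) (\<lambda>z. - h (\<mu> * z) / (2 * \<mu>))"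
  have det: "h z * h (- (q * z)) + h (- z) * h (q * z) = 2" for z
    unfolding h_def by (rule q_series_casoratian[OF q])
  have VU: "V (U x) = x" for x
    unfolding U_def V_def
    by (rule block_map_inverse) (use distinct \<mu>0 det[of "\<mu> * _"] in \<open>simp_all add: field_simps\<close>)
  have UV: "U (V x) = x" for x
    unfolding U_def V_def
    by (rule block_map_inverse) (use distinct \<mu>0 det[of "\<mu> * _"] in \<open>simp_all add: field_simps\<close>)
  have invU: "inv U = V"
    by (rule inv_equality) (simp_all add: VU UV)
  have "bij U"
    by (rule o_bij[of V]) (simp_all add: fun_eq_iff VU UV)
  have deriv: "((\<lambda>z. h (\<alpha> * z)) has_field_derivative
      (\<Sum>n. diffs (q_coeff q) n * (\<alpha> * z) ^ n) * \<alpha>) (at z)" for \<alpha> z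
    unfolding h_def
    by (rule DERIV_chain2[OF q_series_has_field_derivative[OF q]]) (auto intro!: derivative_eq_intros)
  have entire: "\<exists>f'. \<forall>z. (f has_field_derivative f' z) (at z)"
    if "\<And>z. f z = \<beta> * h (\<alpha> * z)" for f \<alpha> \<beta>
  proof -
    have "f = (\<lambda>z. \<beta> * h (\<alpha> * z))" using that by (simp add: fun_eq_iff)
    then show ?thesis
      by (simp only:) (intro exI allI, rule DERIV_cmult[OF deriv])
  qed
  have "holomorphic_map U"
    unfolding U_def
  proof (rule holomorphic_map_block_map)
    show "\<exists>f'. \<forall>z. ((\<lambda>z. h (\<mu> * z)) has_field_derivative f' z) (at z)"
      by (rule entire[of _ "1" "\<mu>"]) (simp add: mult.assoc)
    show "\<exists>f'. \<forall>z. ((\<lambda>z. \<mu> * h (q * (\<mu> * z))) has_field_derivative f' z) (at z)"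
      by (rule entire[of _ "\<mu>" "q * \<mu>"]) (simp add: mult.assoc)
    show "\<exists>f'. \<forall>z. ((\<lambda>z. h (- (\<mu> * z))) has_field_derivative f' z) (at z)"
      by (rule entire[of _ "1" "- \<mu>"]) (simp add: mult.assoc)
    show "\<exists>f'. \<forall>z. ((\<lambda>z. - \<mu> * h (- (q * (\<mu> * z)))) has_field_derivative f' z) (at z)"
      by (rule entire[of _ "- \<mu>" "- (q * \<mu>)"]) (simp add: mult.assoc)
  qed
  moreover have "holomorphic_map V"
    unfolding V_def
  proof (rule holomorphic_map_block_map)
    show "\<exists>f'. \<forall>z. ((\<lambda>z. h (- (q * (\<mu> * z))) / 2) has_field_derivative f' z) (at z)"
      by (rule entire[of _ "1 / 2" "- (q * \<mu>)"]) (simp add: mult.assoc)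
    show "\<exists>f'. \<forall>z. ((\<lambda>z. h (q * (\<mu> * z)) / 2) has_field_derivative f' z) (at z)"
      by (rule entire[of _ "1 / 2" "q * \<mu>"]) (simp add: mult.assoc)
    show "\<exists>f'. \<forall>z. ((\<lambda>z. h (- (\<mu> * z)) / (2 * \<mu>)) has_field_derivative f' z) (at z)"
      by (rule entire[of _ "1 / (2 * \<mu>)" "- \<mu>"]) (simp add: mult.assoc)
    show "\<exists>f'. \<forall>z. ((\<lambda>z. - h (\<mu> * z) / (2 * \<mu>)) has_field_derivative f' z) (at z)"
      by (rule entire[of _ "- 1 / (2 * \<mu>)" "\<mu>"]) (simp add: mult.assoc)
  qed
  ultimately have biholo: "biholomorphic_map U"
    using \<open>bij U\<close> by (simp add: biholomorphic_map_def invU)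
  define L :: "complex ^ 'n \<Rightarrow> complex ^ 'n" where
    "L x = (\<chi> j. (if j = e 1 then \<sigma> else if j = e 2 then - \<sigma> else of_real (l $ j)) * x $ j)" for x
  \<comment> \<open>The relation \<open>R(c z) A(z) = \<plusminus>\<sigma> R(z)\<close> with the values of the series abstracted: \<open>H\<^sub>1\<close> and \<open>H\<^sub>2\<close>
    stand for the values at \<open>\<plusminus>q w\<close> and \<open>\<plusminus>q\<^sup>2 w\<close>.\<close>
  have rows:
    "H\<^sub>1 * (of_real (l $ e 1) * (v + u * z)) + \<mu> * H\<^sub>2 * (of_real (l $ e 2) * u)
      = \<sigma> * ((H\<^sub>2 + \<mu> * z * H\<^sub>1) * u + \<mu> * H\<^sub>1 * v)"
    "H\<^sub>1 * (of_real (l $ e 1) * (v + u * z)) + - \<mu> * H\<^sub>2 * (of_real (l $ e 2) * u)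
      = - \<sigma> * ((H\<^sub>2 - \<mu> * z * H\<^sub>1) * u + - \<mu> * H\<^sub>1 * v)" for H\<^sub>1 H\<^sub>2 u v z
    unfolding sqrts(1)[symmetric] unfolding sqrts(2)[symmetric] by (simp_all add: algebra_simps)
  have conj: "U (gamma_map e l x) = L (U x)" for x
  proof -
    define w where "w = \<mu> * x $ e 3"
    have w: "\<mu> * (q * x $ e 3) = q * w" "\<mu> * x $ e 3 = w" by (simp_all add: w_def)
    have plus: "h w = h (q * (q * w)) + w * h (q * w)"
      using q_series_equation[OF q, of w] by (simp add: h_def power2_eq_square mult.assoc)
    have minus: "h (- w) = h (- (q * (q * w))) - w * h (- (q * w))"
      using q_series_equation[OF q, of "- w"] by (simp add: h_def power2_eq_square mult.assoc)
    have first: "h (q * w) * (of_real (l $ e 1) * (x $ e 2 + x $ e 1 * x $ e 3))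
        + \<mu> * h (q * (q * w)) * (of_real (l $ e 2) * x $ e 1)
        = \<sigma> * (h w * x $ e 1 + \<mu> * h (q * w) * x $ e 2)"
      unfolding plus rows(1) w(2) by (rule refl)
    have second: "h (- (q * w)) * (of_real (l $ e 1) * (x $ e 2 + x $ e 1 * x $ e 3))
        + - \<mu> * h (- (q * (q * w))) * (of_real (l $ e 2) * x $ e 1)
        = - \<sigma> * (h (- w) * x $ e 1 + - \<mu> * h (- (q * w)) * x $ e 2)"
      unfolding minus rows(2) w(2) by (rule refl)
    have "U (gamma_map e l x) $ j = L (U x) $ j" for j
    proof -
      consider "j = e 1" | "j = e 2" | "j \<noteq> e 1" "j \<noteq> e 2" by blast
      then show ?thesis
      proof cases
        case 1
        then show ?thesis
          using distinct first unfolding U_def L_def block_map_def gamma_map_def vec_lambda_beta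
          by (simp only: if_True if_False refl not_sym w simp_thms flip: q_def)
      next
        case 2
        then show ?thesis
          using distinct second unfolding U_def L_def block_map_def gamma_map_def vec_lambda_beta
          by (simp only: if_True if_False refl not_sym w simp_thms flip: q_def)
      next
        case 3
        then show ?thesis
          using distinct by (simp add: U_def L_def block_map_def gamma_map_def)
      qed
    qed
    then show ?thesis by (simp add: vec_eq_iff)
  qed
  have "U \<circ> gamma_map e l \<circ> inv U = L"
    by (simp add: fun_eq_iff invU conj UV)
  moreover have "complex_linear L"
    unfolding complex_linear_iff by (simp add: vec_eq_iff L_def algebra_simps)
  ultimately show ?thesis using biholo by auto
qed

section \<open>Growth of polynomial maps\<close>

lemma monomial_at_growth:
  fixes x :: "complex ^ 'n::finite"
  shows "norm (monomial_at x m) \<le> (1 + norm x) ^ (\<Sum>i\<in>UNIV. m i)"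
proof -
  have "norm (monomial_at x m) = (\<Prod>i\<in>UNIV. norm (x $ i) ^ m i)"
    by (simp add: monomial_at_def norm_power flip: prod_norm)
  also have "\<dots> \<le> (\<Prod>i\<in>UNIV. (1 + norm x) ^ m i)"
  proof (intro prod_mono conjI power_mono)
    show "norm (x $ i) \<le> 1 + norm x" for i
      using Finite_Cartesian_Product.norm_nth_le[of x i] by linarith
  qed simp_all
  finally show ?thesis by (simp add: power_sum)
qed

lemma polynomial_fun_growth:
  assumes "polynomial_fun f"
  shows "\<exists>C k. \<forall>x. norm (f x) \<le> C * (1 + norm x) ^ k"
proof -
  obtain M c where M: "finite M" and f: "\<And>x. f x = (\<Sum>m\<in>M. c m * monomial_at x m)"
    using assms unfolding polynomial_fun_def by metis
  define k where "k = (\<Sum>m\<in>M. \<Sum>i\<in>UNIV. m i)"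
  have "norm (f x) \<le> (\<Sum>m\<in>M. norm (c m)) * (1 + norm x) ^ k" for x
  proof -
    have "norm (f x) \<le> (\<Sum>m\<in>M. norm (c m) * norm (monomial_at x m))"
      unfolding f by (simp add: norm_mult sum_norm_le)
    also have "\<dots> \<le> (\<Sum>m\<in>M. norm (c m) * (1 + norm x) ^ k)"
    proof (intro sum_mono mult_left_mono)
      fix m assume "m \<in> M"
      then have "(\<Sum>i\<in>UNIV. m i) \<le> k"
        unfolding k_def using M by (intro member_le_sum) auto
      then have "(1 + norm x) ^ (\<Sum>i\<in>UNIV. m i) \<le> (1 + norm x) ^ k"
        by (intro power_increasing) auto
      then show "norm (monomial_at x m) \<le> (1 + norm x) ^ k"
        using monomial_at_growth[of x m] by linarith
    qed simp
    finally show ?thesis by (simp add: sum_distrib_right)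
  qed
  then show ?thesis by blast
qed

lemma polynomial_map_growth:
  fixes f :: "complex ^ 'n::finite \<Rightarrow> complex ^ 'n"
  assumes "polynomial_map f"
  shows "\<exists>C k. 0 \<le> C \<and> (\<forall>x. norm (f x) \<le> C * (1 + norm x) ^ k)"
proof -
  have "\<forall>i. \<exists>C k. \<forall>x. norm (f x $ i) \<le> C * (1 + norm x) ^ k"
    using assms unfolding polynomial_map_def by (intro allI polynomial_fun_growth) blast
  then obtain C k where Ck: "\<And>i x. norm (f x $ i) \<le> C i * (1 + norm x) ^ k i"
    by (auto dest!: choice)
  define K where "K = (\<Sum>i\<in>UNIV. k i)"
  have "norm (f x) \<le> (\<Sum>i\<in>UNIV. \<bar>C i\<bar>) * (1 + norm x) ^ K" for x
  proof -
    have "norm (f x) \<le> (\<Sum>i\<in>UNIV. norm (f x $ i))"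
      by (simp add: norm_vec_def L2_set_le_sum)
    also have "\<dots> \<le> (\<Sum>i\<in>UNIV. \<bar>C i\<bar> * (1 + norm x) ^ K)"
    proof (intro sum_mono)
      fix i
      have "norm (f x $ i) \<le> C i * (1 + norm x) ^ k i" by (rule Ck)
      also have "\<dots> \<le> \<bar>C i\<bar> * (1 + norm x) ^ K"
        unfolding K_def
        by (intro mult_mono power_increasing member_le_sum) auto
      finally show "norm (f x $ i) \<le> \<bar>C i\<bar> * (1 + norm x) ^ K" .
    qed
    finally show ?thesis by (simp add: sum_distrib_right)
  qed
  moreover have "0 \<le> (\<Sum>i\<in>UNIV. \<bar>C i\<bar>)" by (simp add: sum_nonneg)
  ultimately show ?thesis by blast
qed

text \<open>
  The exponent \<open>K\<close> does not depend on \<open>n\<close>: in \<open>U\<^sup>-\<^sup>1 \<circ> L\<^sup>n \<circ> U\<close> the linear middle factor changes only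
  the constant.
\<close>

lemma conjugate_iterates_growth:
  fixes U g :: "complex ^ 'n::finite \<Rightarrow> complex ^ 'n"
  assumes U: "polynomial_automorphism U" and lin: "complex_linear (U \<circ> g \<circ> inv U)"
  shows "\<exists>K. \<forall>n. \<exists>C. \<forall>x. norm ((g ^^ n) x) \<le> C * (1 + norm x) ^ K"
proof -
  define L where "L = U \<circ> g \<circ> inv U"
  have "bij U" and "polynomial_map U" and "polynomial_map (inv U)"
    using U by (auto simp: polynomial_automorphism_def)
  then have inv: "inv U (U x) = x" for x
    by (simp add: bij_is_inj)
  obtain C1 k1 where C1: "0 \<le> C1" "\<And>x. norm (U x) \<le> C1 * (1 + norm x) ^ k1"
    using polynomial_map_growth[OF \<open>polynomial_map U\<close>] by blast
  obtain C2 k2 where C2: "0 \<le> C2" "\<And>x. norm (inv U x) \<le> C2 * (1 + norm x) ^ k2"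
    using polynomial_map_growth[OF \<open>polynomial_map (inv U)\<close>] by blast
  obtain B where B: "0 < B" "\<And>x. norm (L x) \<le> norm x * B"
    using bounded_linear.pos_bounded[OF complex_linear_imp_bounded_linear[OF lin]]
    by (auto simp: L_def)
  have LU: "L (U y) = U (g y)" for y by (simp add: L_def inv)
  have iter: "U ((g ^^ n) x) = (L ^^ n) (U x)" for n x
    by (induction n) (simp_all flip: LU)
  have iter_bound: "norm ((L ^^ n) y) \<le> B ^ n * norm y" for n y
  proof (induction n)
    case (Suc n)
    have "norm ((L ^^ Suc n) y) \<le> norm ((L ^^ n) y) * B" using B(2) by simp
    also have "\<dots> \<le> B ^ n * norm y * B" using Suc B(1) by (intro mult_right_mono) auto
    finally show ?case by (simp add: ac_simps)
  qed simp
  have "norm ((g ^^ n) x) \<le> C2 * (1 + B ^ n * C1) ^ k2 * (1 + norm x) ^ (k1 * k2)" for n x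
  proof -
    have one: "1 \<le> (1 + norm x) ^ k1" by (simp add: one_le_power)
    have "norm ((g ^^ n) x) = norm (inv U ((L ^^ n) (U x)))"
      by (simp add: inv flip: iter)
    also have "\<dots> \<le> C2 * (1 + norm ((L ^^ n) (U x))) ^ k2"
      by (rule C2)
    also have "\<dots> \<le> C2 * ((1 + B ^ n * C1) * (1 + norm x) ^ k1) ^ k2"
    proof (intro mult_left_mono power_mono)
      have "norm ((L ^^ n) (U x)) \<le> B ^ n * norm (U x)" by (rule iter_bound)
      also have "\<dots> \<le> B ^ n * (C1 * (1 + norm x) ^ k1)"
        using C1(2) B(1) by (intro mult_left_mono) auto
      finally show "1 + norm ((L ^^ n) (U x)) \<le> (1 + B ^ n * C1) * (1 + norm x) ^ k1"
        using one unfolding distrib_right mult_1_left mult.assoc by linarith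
    qed (use C2(1) in auto)
    finally show ?thesis
      by (simp add: power_mult_distrib power_mult mult.assoc)
  qed
  then show ?thesis
    by (intro exI allI)
qed

section \<open>Absence of a polynomial linearization\<close>

text \<open>
  The starting point has \<open>x\<^sub>1 = x\<^sub>3 = t\<close>, where the monomial \<open>x\<^sub>1 x\<^sub>3\<^sup>n\<close> is \<open>t ^ Suc n\<close>. The first three
  coordinates stay real and nonnegative along the orbit, so dropping the summand \<open>x\<^sub>2\<close> in each step
  leaves a lower bound for the first coordinate. The conclusions about the second and third
  coordinate carry the induction.
\<close>

lemma gamma_iterates_lower_bound:
  fixes e :: "nat \<Rightarrow> 'n::finite" and l :: "real ^ 'n"
  assumes distinct: "e 1 \<noteq> e 2" "e 1 \<noteq> e 3" "e 2 \<noteq> e 3"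
    and pos: "0 < l $ e 1" "0 < l $ e 2" "0 < l $ e 3"
  shows "\<exists>k>0. \<forall>t\<ge>0. \<exists>u\<ge>k * t ^ Suc n. \<exists>v\<ge>0.
     (gamma_map e l ^^ n) (axis (e 1) (of_real t) + axis (e 3) (of_real t)) $ e 1 = of_real u \<and>
     (gamma_map e l ^^ n) (axis (e 1) (of_real t) + axis (e 3) (of_real t)) $ e 2 = of_real v \<and>
     (gamma_map e l ^^ n) (axis (e 1) (of_real t) + axis (e 3) (of_real t)) $ e 3
       = of_real ((l $ e 3) ^ n * t)"
proof (induction n)
  case 0
  show ?case
  proof (rule exI[of _ 1], intro conjI allI impI)
    fix t :: real
    have "1 * t ^ Suc 0 \<le> t" "(0::real) \<le> 0" by simp_all
    moreover have "(axis (e 1) (of_real t) + axis (e 3) (of_real t)) $ e 1 = complex_of_real t"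
      "(axis (e 1) (of_real t) + axis (e 3) (of_real t)) $ e 2 = complex_of_real 0"
      "(axis (e 1) (of_real t) + axis (e 3) (of_real t)) $ e 3
        = complex_of_real ((l $ e 3) ^ 0 * t)"
      using distinct by (simp_all add: axis_def)
    ultimately show "\<exists>u\<ge>1 * t ^ Suc 0. \<exists>v\<ge>0.
     (gamma_map e l ^^ 0) (axis (e 1) (of_real t) + axis (e 3) (of_real t)) $ e 1 = of_real u \<and>
     (gamma_map e l ^^ 0) (axis (e 1) (of_real t) + axis (e 3) (of_real t)) $ e 2 = of_real v \<and>
     (gamma_map e l ^^ 0) (axis (e 1) (of_real t) + axis (e 3) (of_real t)) $ e 3
       = of_real ((l $ e 3) ^ 0 * t)"
      unfolding funpow_0 by blast
  qed simp
next
  case (Suc n)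
  define y where
    "y t = (gamma_map e l ^^ n) (axis (e 1) (of_real t) + axis (e 3) (of_real t))" for t
  obtain k where k: "k > 0" and IH: "\<And>t. t \<ge> 0 \<Longrightarrow> \<exists>u\<ge>k * t ^ Suc n. \<exists>v\<ge>0.
      y t $ e 1 = of_real u \<and> y t $ e 2 = of_real v \<and> y t $ e 3 = of_real ((l $ e 3) ^ n * t)"
    using Suc unfolding y_def by blast
  have step: "(gamma_map e l ^^ Suc n) (axis (e 1) (of_real t) + axis (e 3) (of_real t))
      = gamma_map e l (y t)" for t
    by (simp add: y_def)
  define k' where "k' = l $ e 1 * k * (l $ e 3) ^ n"
  have "\<exists>u'\<ge>k' * t ^ Suc (Suc n). \<exists>v'\<ge>0.
      gamma_map e l (y t) $ e 1 = of_real u' \<and> gamma_map e l (y t) $ e 2 = of_real v' \<and>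
      gamma_map e l (y t) $ e 3 = of_real ((l $ e 3) ^ Suc n * t)" if t: "t \<ge> 0" for t
  proof -
    obtain u v where u: "u \<ge> k * t ^ Suc n" and v: "v \<ge> 0" and y: "y t $ e 1 = of_real u"
      "y t $ e 2 = of_real v" "y t $ e 3 = of_real ((l $ e 3) ^ n * t)"
      using IH[OF t] by blast
    have "0 \<le> k * t ^ Suc n" using k t by simp
    then have "u \<ge> 0" using u by linarith
    have "k * t ^ Suc n * ((l $ e 3) ^ n * t) \<le> u * ((l $ e 3) ^ n * t)"
      using u pos t by (intro mult_right_mono) auto
    then have "l $ e 1 * (k * t ^ Suc n * ((l $ e 3) ^ n * t))
        \<le> l $ e 1 * (v + u * ((l $ e 3) ^ n * t))"
      using pos v by (intro mult_left_mono) auto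
    then have "l $ e 1 * (v + u * ((l $ e 3) ^ n * t)) \<ge> k' * t ^ Suc (Suc n)"
      by (simp add: k'_def ac_simps)
    moreover have "l $ e 2 * u \<ge> 0" using \<open>u \<ge> 0\<close> pos by simp
    moreover have "gamma_map e l (y t) $ e 1 = of_real (l $ e 1 * (v + u * ((l $ e 3) ^ n * t)))"
      "gamma_map e l (y t) $ e 2 = of_real (l $ e 2 * u)"
      "gamma_map e l (y t) $ e 3 = of_real ((l $ e 3) ^ Suc n * t)"
      unfolding gamma_map_def using distinct y by simp_all
    ultimately show ?thesis by blast
  qed
  moreover have "k' > 0" using k pos by (simp add: k'_def)
  ultimately show ?case
    unfolding step by blast
qed

text \<open>
  The \<open>K\<close>-th iterate, with \<open>K\<close> the uniform growth exponent, already grows too fast: it is at least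
  of the order of \<open>t ^ Suc K\<close>.
\<close>

lemma gamma_map_not_polynomially_linearizable:
  fixes e :: "nat \<Rightarrow> 'n::finite" and l :: "real ^ 'n"
  assumes distinct: "e 1 \<noteq> e 2" "e 1 \<noteq> e 3" "e 2 \<noteq> e 3"
    and pos: "0 < l $ e 1" "0 < l $ e 2" "0 < l $ e 3"
    and U: "polynomial_automorphism U"
  shows "\<not> complex_linear (U \<circ> gamma_map e l \<circ> inv U)"
proof
  assume "complex_linear (U \<circ> gamma_map e l \<circ> inv U)"
  from conjugate_iterates_growth[OF U this] obtain K C where
    upper: "\<And>x. norm ((gamma_map e l ^^ K) x) \<le> C * (1 + norm x) ^ K"
    by blast
  obtain k where k: "k > 0" and lower: "\<And>t. t \<ge> 0 \<Longrightarrow> \<exists>u\<ge>k * t ^ Suc K.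
      (gamma_map e l ^^ K) (axis (e 1) (of_real t) + axis (e 3) (of_real t)) $ e 1 = of_real u"
    using gamma_iterates_lower_bound[OF distinct pos, of K] by blast
  have norm_axis: "norm (axis i z :: complex ^ 'n) = norm z" for i z
    by (simp add: norm_eq_sqrt_inner inner_axis_axis)
  have bound: "k * t \<le> \<bar>C\<bar> * 3 ^ K" if t: "t \<ge> 1" for t
  proof -
    define x where "x = axis (e 1) (complex_of_real t) + axis (e 3) (complex_of_real t)"
    obtain u where u: "u \<ge> k * t ^ Suc K" "(gamma_map e l ^^ K) x $ e 1 = of_real u"
      using lower[of t] t unfolding x_def by auto
    have "norm x \<le> t + t"
      unfolding x_def using norm_triangle_ineq[of "axis (e 1) (complex_of_real t)"
          "axis (e 3) (complex_of_real t)"] t by (simp add: norm_axis)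
    then have x: "1 + norm x \<le> 3 * t" using t by linarith
    have "k * t * t ^ K \<le> norm ((gamma_map e l ^^ K) x $ e 1)"
      using u by (simp add: mult.assoc)
    also have "\<dots> \<le> C * (1 + norm x) ^ K"
      using upper[of x] Finite_Cartesian_Product.norm_nth_le order_trans by blast
    also have "\<dots> \<le> \<bar>C\<bar> * (3 * t) ^ K"
      using x by (intro mult_mono power_mono) auto
    finally have "k * t * t ^ K \<le> \<bar>C\<bar> * 3 ^ K * t ^ K"
      by (simp add: power_mult_distrib)
    then show ?thesis
      using t by (simp add: mult_le_cancel_right)
  qed
  \<comment> \<open>Large enough for \<open>k * t\<close> to exceed the bound by \<open>k\<close>.\<close>
  define t where "t = 1 + \<bar>C\<bar> * 3 ^ K / k"
  have "k * t = k + \<bar>C\<bar> * 3 ^ K"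
    using k by (simp add: t_def field_simps)
  moreover have "t \<ge> 1"
    using k by (simp add: t_def)
  ultimately show False
    using bound[of t] k by linarith
qed

theorem theorem4:
  fixes e :: "nat \<Rightarrow> 'n::finite" and l :: "real ^ 'n"
  assumes "CARD('n) \<ge> 3"
    and "bij_betw e {1..CARD('n)} UNIV"
    and "\<forall>i\<in>{1..CARD('n)}. 0 < l $ e i \<and> l $ e i < 1 / 2"
    and "algebraically_independent_over_rat l"
  shows "(\<exists>U :: complex ^ 'n \<Rightarrow> complex ^ 'n.
            biholomorphic_map U \<and> complex_linear (U \<circ> gamma_map e l \<circ> inv U)) \<and>
         (\<nexists>U :: complex ^ 'n \<Rightarrow> complex ^ 'n.
            polynomial_automorphism U \<and> complex_linear (U \<circ> gamma_map e l \<circ> inv U))"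
proof -
  have "inj_on e {1..CARD('n)}"
    using assms(2) by (rule bij_betw_imp_inj_on)
  then have distinct: "e 1 \<noteq> e 2" "e 1 \<noteq> e 3" "e 2 \<noteq> e 3"
    using assms(1) by (auto simp: inj_on_eq_iff)
  have pos: "0 < l $ e 1" "0 < l $ e 2" "0 < l $ e 3" and "l $ e 3 < 1 / 2"
    using assms(1,3) by auto
  then have "\<bar>l $ e 3\<bar> < 1" by simp
  then show ?thesis
    using gamma_map_holomorphically_linearizable[OF distinct pos(1,2)]
      gamma_map_not_polynomially_linearizable[OF distinct pos] by blast
qed

end
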